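(* Let $(L_n)_{n\ge 0}$ be the sequence of Lucas numbers. The Diophantine equation $L_n-2^x3^y=0$ in integers $n,x,y\ge 0$ has exactly five solutions, namely $$(n,x,y)\in\{(0,1,0),\ (1,0,0),\ (2,0,1),\ (3,2,0),\ (6,1,2)\}.$$
   Context: The Lucas numbers are defined by $L_0=2$, $L_1=1$ and $L_{n+2}=L_{n+1}+L_n$ for all $n\ge 0$. *)

theory Defs
  imports Main
begin

fun lucas :: "nat \<Rightarrow> int" where
  "lucas 0 = 2"
| "lucas (Suc 0) = 1"
| "lucas (Suc (Suc n)) = lucas (Suc n) + lucas n"

end

theory Submission
  imports Defs
begin

text \<open>
  Both exponents are bounded by 2 through divisibility alone, after which finitely many values
  of the Lucas sequence remain.

  For the power of 2: the sequence has period 12 modulo 8, and none of its first 12 terms is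
  divisible by 8 (\<open>lucas_not_dvd_8\<close>).

  For the power of 3: the key is that \<open>L\<^sub>1\<^sub>8 = 5778 = 2 \<cdot> 27 \<cdot> 107\<close>. Translating the index by 36
  changes the sign of \<open>L\<^sub>n\<close> modulo \<open>L\<^sub>1\<^sub>8\<close>, so divisibility of \<open>L\<^sub>n\<close> by 27 or by 107 depends only
  on \<open>n mod 36\<close>. Among the residues only 18 makes 27 a divisor, and it makes 107 a divisor as well.
  Hence \<open>27 dvd L\<^sub>n\<close> forces \<open>107 dvd L\<^sub>n\<close> (\<open>lucas_dvd_107\<close>), which is impossible for a number
  of the form \<open>2\<^sup>x 3\<^sup>y\<close>.

  So \<open>L\<^sub>n \<le> 36\<close>, and the growth bound \<open>n \<le> L\<^sub>n\<close> for positive \<open>n\<close> leaves a finite check.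
\<close>

text \<open>
  Unfolding the defining recursion of \<^const>\<open>lucas\<close> at a numeral takes exponentially many
  steps. Carrying two consecutive terms makes the evaluation linear.
\<close>

fun fib_like :: "int \<Rightarrow> int \<Rightarrow> nat \<Rightarrow> int" where
  "fib_like a b 0 = a"
| "fib_like a b (Suc n) = fib_like b (a + b) n"

lemma fib_like_lucas: "fib_like (lucas m) (lucas (Suc m)) n = lucas (m + n)"
proof (induction n arbitrary: m)
  case (Suc n)
  show ?case using Suc.IH[of "Suc m"] by (simp add: add.commute)
qed simp

lemma lucas_eq_fib_like: "lucas n = fib_like 2 1 n"
  using fib_like_lucas[of 0 n] by simp

lemma lucas_add_rec: "lucas (Suc (Suc n) + k) = lucas (Suc n + k) + lucas (n + k)"
  by simp

lemma le_lucas: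
  assumes "n > 0"
  shows "int n \<le> lucas n"
proof -
  \<comment> \<open>The recursion increases a term by the one before it, so a lower bound of 1 on that one is carried along.\<close>
  have "int (Suc m) \<le> lucas (Suc m) \<and> 1 \<le> lucas m" for m
    by (induction m) auto
  from this[of "n - 1"] show ?thesis using assms by simp
qed

text \<open>
  This is \<open>L\<^sub>n\<^sub>+\<^sub>1\<^sub>2 - L\<^sub>n = 5 F\<^sub>6 F\<^sub>n\<^sub>+\<^sub>6\<close> with \<open>F\<^sub>6 = 8\<close>, where the Fibonacci factor
  \<open>5 F\<^sub>n\<^sub>+\<^sub>6\<close> is written as \<open>L\<^sub>n\<^sub>+\<^sub>7 + L\<^sub>n\<^sub>+\<^sub>5\<close>. Both sides satisfy the Lucas recursion in \<open>n\<close>, so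
  agreement at 0 and 1 suffices.
\<close>

lemma lucas_add_12: "lucas (n + 12) = lucas n + 8 * (lucas (n + 7) + lucas (n + 5))"
proof (induction n rule: lucas.induct)
  case (3 n)
  then show ?case unfolding lucas_add_rec lucas.simps(3) by algebra
qed (simp_all add: lucas_eq_fib_like numeral_eq_Suc del: lucas.simps)

lemma lucas_not_dvd_8: "\<not> 8 dvd lucas n"
proof (induction n rule: less_induct)
  case (less n)
  show ?case
  proof (cases "n < 12")
    case True
    have "\<forall>r\<in>set [0..<12]. \<not> 8 dvd fib_like 2 1 r"
      by code_simp
    with True show ?thesis by (simp add: lucas_eq_fib_like)
  next
    case False
    then obtain m where m: "n = m + 12" by (metis add.commute le_Suc_ex not_less)
    then have "\<not> 8 dvd lucas m" using less by simp
    then show ?thesis unfolding m lucas_add_12 by (metis dvd_add_left_iff dvd_triv_left)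
  qed
qed

text \<open>
  The case \<open>k = 18\<close> of \<open>L\<^sub>n\<^sub>+\<^sub>2\<^sub>k + (-1)\<^sup>k L\<^sub>n = L\<^sub>k L\<^sub>n\<^sub>+\<^sub>k\<close>, again an identity between solutions of
  the Lucas recursion in \<open>n\<close>.
\<close>

lemma lucas_add_36: "lucas (n + 36) + lucas n = 5778 * lucas (n + 18)"
proof (induction n rule: lucas.induct)
  case (3 n)
  then show ?case unfolding lucas_add_rec lucas.simps(3) by algebra
qed (simp_all add: lucas_eq_fib_like numeral_eq_Suc del: lucas.simps)

text \<open>
  For a divisor \<open>d\<close> of \<open>L\<^sub>1\<^sub>8\<close> the preceding identity reads \<open>L\<^sub>n\<^sub>+\<^sub>3\<^sub>6 \<equiv> - L\<^sub>n\<close> modulo \<open>d\<close>. The sign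
  does not affect divisibility, so 36 acts as a period for it.
\<close>

lemma dvd_lucas_mod_36:
  assumes "d dvd 5778"
  shows "d dvd lucas n \<longleftrightarrow> d dvd lucas (n mod 36)"
proof (induction n rule: less_induct)
  case (less n)
  show ?case
  proof (cases "n < 36")
    case False
    then obtain m where m: "n = m + 36" by (metis add.commute le_Suc_ex not_less)
    have "d dvd lucas (m + 36) + lucas m"
      unfolding lucas_add_36 using assms by simp
    then have "d dvd lucas n \<longleftrightarrow> d dvd lucas m"
      unfolding m by (metis dvd_add_left_iff dvd_add_right_iff)
    also have "\<dots> \<longleftrightarrow> d dvd lucas (m mod 36)" using less.IH[of m] m by simp
    also have "m mod 36 = n mod 36" using m by simp
    finally show ?thesis .
  qed simp
qed

text \<open>
  The indices with \<open>27 dvd L\<^sub>n\<close> are those congruent to 18 modulo 36, and then already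
  \<open>L\<^sub>1\<^sub>8 = 2 \<cdot> 27 \<cdot> 107\<close> divides \<open>L\<^sub>n\<close>. Its factor 107 is what a product of powers of 2
  and 3 cannot have.
\<close>

lemma lucas_dvd_107:
  assumes "27 dvd lucas n"
  shows "107 dvd lucas n"
proof -
  have "\<forall>r\<in>set [0..<36]. 27 dvd fib_like 2 1 r \<longrightarrow> 107 dvd fib_like 2 1 r"
    by code_simp
  moreover have "n mod 36 \<in> set [0..<36]" by simp
  ultimately have "27 dvd lucas (n mod 36) \<longrightarrow> 107 dvd lucas (n mod 36)"
    unfolding lucas_eq_fib_like by blast
  with assms show ?thesis
    using dvd_lucas_mod_36[of 27 n] dvd_lucas_mod_36[of 107 n] by simp
qed

lemma not_107_dvd: "\<not> (107::int) dvd 2 ^ x * 3 ^ y"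
proof
  assume dvd: "(107::int) dvd 2 ^ x * 3 ^ y"
  have "coprime (107::int) 2" "coprime (107::int) 3"
    by code_simp+
  then have "coprime (107::int) (2 ^ x * 3 ^ y)" by simp
  with dvd have "is_unit (107::int)" using coprime_absorb_left by blast
  then show False by simp
qed

lemma lucas_eq_imp_exponents_le_2:
  assumes "lucas n = 2 ^ x * 3 ^ y"
  shows "x \<le> 2" "y \<le> 2"
proof -
  show "x \<le> 2"
  proof (rule ccontr)
    assume "\<not> x \<le> 2"
    then have "(2::int) ^ 3 dvd 2 ^ x" by (intro le_imp_power_dvd) simp
    then have "8 dvd lucas n" unfolding assms by (intro dvd_mult2) simp
    then show False using lucas_not_dvd_8 by blast
  qed
  show "y \<le> 2"
  proof (rule ccontr)
    assume "\<not> y \<le> 2"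
    then have "(3::int) ^ 3 dvd 3 ^ y" by (intro le_imp_power_dvd) simp
    then have "27 dvd lucas n" unfolding assms by (intro dvd_mult) simp
    then have "107 dvd lucas n" by (rule lucas_dvd_107)
    then show False unfolding assms using not_107_dvd by blast
  qed
qed

theorem theorem1p1:
  shows "{(n::nat, x::nat, y::nat). lucas n - 2 ^ x * 3 ^ y = 0} =
         {(0, 1, 0), (1, 0, 0), (2, 0, 1), (3, 2, 0), (6, 1, 2)}"
    (is "?S = ?T")
proof
  have small_terms: "lucas 1 = 1" "lucas 2 = 3" "lucas 3 = 4" "lucas 6 = 18"
    unfolding lucas_eq_fib_like by code_simp+
  \<comment> \<open>The listed values are the numbers \<open>2\<^sup>x 3\<^sup>y\<close> with both exponents at most 2.\<close>
  have small: "\<forall>n\<in>set [0..<37].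
    fib_like 2 1 n \<in> set [1, 2, 3, 4, 6, 9, 12, 18, 36] \<longrightarrow> n \<in> set [0, 1, 2, 3, 6]"
    by code_simp
  have "(n, x, y) \<in> ?T" if eq: "lucas n = 2 ^ x * 3 ^ y" for n x y
  proof -
    have xy: "x \<in> {0, 1, 2}" "y \<in> {0, 1, 2}"
      using lucas_eq_imp_exponents_le_2[OF eq] by auto
    then have "lucas n \<in> set [1, 2, 3, 4, 6, 9, 12, 18, 36]"
      unfolding eq by auto
    moreover from this have "n \<le> 36" using le_lucas[of n] by (cases "n = 0") auto
    then have "n \<in> set [0..<37]" by simp
    ultimately have "n \<in> set [0, 1, 2, 3, 6]"
      using small unfolding lucas_eq_fib_like by blast
    with eq xy show ?thesis
      by (simp only: list.set insert_iff empty_iff simp_thms, elim disjE)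
        (simp_all add: small_terms)
  qed
  then show "?S \<subseteq> ?T" by auto
  show "?T \<subseteq> ?S" by (auto simp: small_terms)
qed

end
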